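(* Let $I\times J=[a,b]\times[c,d]\subset\mathbb{R}^2$ and $M,N\in\mathbb{N}\cup\{0\}$. Let $P,f:I\times J\to\mathbb{R}$ be integrable functions and suppose that $f$ has continuous partial derivatives $f_{(i,j)}$ for $i\in\{0,1,\ldots,M+1\}$ and $j\in\{0,1,\ldots,N+1\}$. Then \begin{align*} &\int_a^b\int_c^d P(y,z)f(y,z)\,dz\,dy\\ &=\sum_{i=0}^{M}\sum_{j=0}^{N}\int_a^b\int_c^d P(y,z)\frac{(b-y)^i}{i!}\frac{(d-z)^j}{j!}(-1)^{i+j}f_{(i,j)}(b,d)\,dz\,dy\\ &\quad+\sum_{j=0}^{N}\int_a^b\int_a^s\int_c^d P(y,z)\frac{(s-y)^M}{M!}\frac{(d-z)^j}{j!}(-1)^{M+j+1}f_{(M+1,j)}(s,d)\,dz\,dy\,ds\\ &\quad+\sum_{i=0}^{M}\int_c^d\int_a^b\int_c^t P(y,z)\frac{(b-y)^i}{i!}\frac{(t-z)^N}{N!}(-1)^{i+N+1}f_{(i,N+1)}(b,t)\,dz\,dy\,dt\\ &\quad+\int_a^b\int_c^d\int_a^s\int_c^t P(y,z)\frac{(s-y)^M}{M!}\frac{(t-z)^N}{N!}(-1)^{M+N}f_{(M+1,N+1)}(s,t)\,dz\,dy\,dt\,ds. \end{align*}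
   Context: $f_{(i,j)}=\dfrac{\partial^{i+j}f}{\partial y^i\partial z^j}=\dfrac{\partial^{i+j}f}{\partial z^j\partial y^i}$, with $f_{(0,0)}=f$. Convention: $(\cdot)^0=1$. *)

theory Defs
  imports "HOL-Analysis.Analysis"
begin

text \<open>
  \<open>has_continuous_partials f F m n I J\<close>: the mixed partial derivatives of \<open>f\<close> of orders
  \<open>(i, j)\<close> with \<open>i \<le> m\<close> and \<open>j \<le> n\<close> exist and are continuous on \<open>I \<times> J\<close>, and
  \<open>F i j\<close> is the one of order \<open>(i, j)\<close>. Since \<open>F i j\<close> arises both from \<open>F (i - 1) j\<close> by
  differentiation in the first variable and from \<open>F i (j - 1)\<close> by differentiation in the
  second one, it is the common value of both iterated derivatives
  (\<open>y\<close>-derivatives first or \<open>z\<close>-derivatives first). Derivatives are taken within \<open>I\<close> and \<open>J\<close>,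
  that is, they are one-sided at end points of closed intervals.
\<close>

definition has_continuous_partials ::
  "(real \<times> real \<Rightarrow> real) \<Rightarrow> (nat \<Rightarrow> nat \<Rightarrow> real \<times> real \<Rightarrow> real) \<Rightarrow>
    nat \<Rightarrow> nat \<Rightarrow> real set \<Rightarrow> real set \<Rightarrow> bool" where
  "has_continuous_partials f F m n I J \<longleftrightarrow>
    (\<forall>p\<in>I \<times> J. F 0 0 p = f p) \<and>
    (\<forall>i<m. \<forall>j\<le>n. \<forall>y\<in>I. \<forall>z\<in>J.
      ((\<lambda>u. F i j (u, z)) has_real_derivative F (Suc i) j (y, z)) (at y within I)) \<and>
    (\<forall>i\<le>m. \<forall>j<n. \<forall>y\<in>I. \<forall>z\<in>J.
      ((\<lambda>v. F i j (y, v)) has_real_derivative F i (Suc j) (y, z)) (at z within J)) \<and>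
    (\<forall>i\<le>m. \<forall>j\<le>n. continuous_on (I \<times> J) (F i j))"

end

theory Submission
  imports Defs
begin

text \<open>
  Taylor's formula with integral remainder, expanded at the right end point, is applied to \<open>f\<close> in the
  first variable and then to each resulting coefficient and remainder in the second one. Multiplying
  by \<open>P\<close> and integrating, Fubini's theorem moves the integration over the remainder parameters
  \<open>s\<close>, \<open>t\<close> outside the one over \<open>y \<le> s\<close>, \<open>z \<le> t\<close>. As \<open>P\<close> is only Lebesgue measurable, so that some of
  its sections may fail to be measurable, it is first replaced by an almost everywhere equal Borel
  function \<open>p\<close>, for which plane and iterated integrals can be exchanged freely.
\<close>

section \<open>One-variable Taylor formula at the right end point\<close>

text \<open>This is \<open>(u - e)^i / i!\<close> with the sign split off, so that the power has the
  nonnegative base \<open>e - u\<close> when \<open>u\<close> \<le> \<open>e\<close>. It serves both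
  as Taylor coefficient, with \<open>e\<close> the end point, and as remainder kernel, with
  \<open>e\<close> the integration variable.\<close>

definition taylor_weight :: "nat \<Rightarrow> real \<Rightarrow> real \<Rightarrow> real" where
  "taylor_weight i e u = (-1) ^ i * ((e - u) ^ i / fact i)"

lemma continuous_on_taylor_weight [continuous_intros]:
  "continuous_on S e \<Longrightarrow> continuous_on S u \<Longrightarrow> continuous_on S (\<lambda>x. taylor_weight i (e x) (u x))"
  unfolding taylor_weight_def by (intro continuous_intros) auto

text \<open>By the product rule, summand \<open>i\<close> contributes one term from the power and
  one from \<open>g i\<close>. The former cancels the latter of summand \<open>i - 1\<close>, so
  that only the last derivative term survives.\<close>

lemma has_real_derivative_taylor_telescope:
  fixes g :: "nat \<Rightarrow> real \<Rightarrow> real"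
  assumes "\<And>i. i \<le> M \<Longrightarrow> (g i has_real_derivative g (Suc i) s) (at s within S)"
  shows "((\<lambda>s. \<Sum>i=0..M. (-1) ^ i * ((s - u) ^ i / fact i) * g i s) has_real_derivative
           (-1) ^ M * ((s - u) ^ M / fact M) * g (Suc M) s) (at s within S)"
  using assms
proof (induction M)
  case 0
  then show ?case by (auto intro!: derivative_eq_intros)
next
  case (Suc M)
  have pow: "((\<lambda>s. (s - u) ^ Suc M / fact (Suc M)) has_real_derivative (s - u) ^ M / fact M) (at s within S)"
    by (rule derivative_eq_intros refl | simp)+
  have "((\<lambda>s. (-1) ^ Suc M * ((s - u) ^ Suc M / fact (Suc M)) * g (Suc M) s) has_real_derivative
      (-1) ^ Suc M * ((s - u) ^ M / fact M) * g (Suc M) s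
      + (-1) ^ Suc M * ((s - u) ^ Suc M / fact (Suc M)) * g (Suc (Suc M)) s) (at s within S)"
    using DERIV_cmult[OF DERIV_mult[OF pow Suc.prems[of "Suc M"]], of "(-1) ^ Suc M"]
    by (simp add: algebra_simps)
  from DERIV_add[OF Suc.IH this] Suc.prems show ?case
    by (simp add: algebra_simps)
qed

text \<open>The telescoping sum is a primitive in \<open>s\<close> of the remainder integrand, so
  the fundamental theorem of calculus on \<open>{u..b}\<close> gives its increment. Its value at
  \<open>b\<close> is the Taylor polynomial.\<close>

lemma taylor_right_endpoint:
  fixes g :: "nat \<Rightarrow> real \<Rightarrow> real"
  assumes u: "u \<in> {a..b}"
    and der: "\<And>i s. i \<le> M \<Longrightarrow> s \<in> {a..b} \<Longrightarrow>
      (g i has_real_derivative g (Suc i) s) (at s within {a..b})"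
    and cont: "continuous_on {a..b} (g (Suc M))"
  shows "g 0 u = (\<Sum>i=0..M. taylor_weight i b u * g i b)
    - (LINT s:{u..b}|lebesgue. taylor_weight M s u * g (Suc M) s)"
proof -
  let ?S = "\<lambda>s. \<Sum>i=0..M. (-1) ^ i * ((s - u) ^ i / fact i) * g i s"
  let ?D = "\<lambda>s. (-1) ^ M * ((s - u) ^ M / fact M) * g (Suc M) s"
  have "(?D has_integral ?S b - ?S u) {u..b}"
  proof (rule fundamental_theorem_of_calculus)
    fix s assume s: "s \<in> {u..b}"
    have "(?S has_real_derivative ?D s) (at s within {a..b})"
      using u s by (intro has_real_derivative_taylor_telescope der) auto
    then have "(?S has_real_derivative ?D s) (at s within {u..b})"
      by (rule DERIV_subset) (use u in auto)
    then show "(?S has_vector_derivative ?D s) (at s within {u..b})"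
      by (simp add: has_real_derivative_iff_has_vector_derivative)
  qed (use u in auto)
  \<comment> \<open>At \<open>s = u\<close> every positive power of \<open>s - u\<close> vanishes,
    and \<open>0 ^ 0 = 1\<close> leaves the summand \<open>i = 0\<close>.\<close>
  moreover have "?S u = g 0 u"
    by (auto simp: sum.atLeast_Suc_atMost intro!: sum.neutral)
  ultimately have "(?D has_integral ?S b - g 0 u) {u..b}"
    by simp
  then have D: "integral {u..b} ?D = ?S b - g 0 u"
    by (rule integral_unique)
  have "continuous_on {u..b} ?D"
    by (intro continuous_intros continuous_on_subset[OF cont]) (use u in auto)
  then have "?D absolutely_integrable_on {u..b}"
    by (rule absolutely_integrable_continuous_real)
  then have "(LINT s:{u..b}|lebesgue. ?D s) = ?S b - g 0 u"
    unfolding D[symmetric] by (rule set_lebesgue_integral_eq_integral(2))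
  then show ?thesis by (simp add: taylor_weight_def)
qed

section \<open>Lebesgue integrals computed through Borel functions\<close>

text \<open>Completeness of Lebesgue measure makes \<open>h\<close> measurable as soon as it agrees
  almost everywhere with a Borel function; integrals of Borel functions do not change under
  completion.\<close>

lemma integral_lebesgue_cong_AE_borel:
  fixes g :: "'a::euclidean_space \<Rightarrow> real"
  assumes "g \<in> borel_measurable lborel" "AE x in lborel. h x = g x"
  shows "(LINT x|lebesgue. h x) = (LINT x|lborel. g x)"
proof -
  have g: "g \<in> borel_measurable lebesgue"
    using assms(1) by (simp add: measurable_completion)
  have ae: "AE x in lebesgue. h x = g x"
    using assms(2) by (rule AE_completion)
  have h: "h \<in> borel_measurable lebesgue"
    using borel_measurable_AE[OF g] ae by (simp add: eq_commute)
  have "(LINT x|lebesgue. h x) = (LINT x|lebesgue. g x)"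
    using h g ae by (rule integral_cong_AE)
  also have "\<dots> = (LINT x|lborel. g x)"
    using assms(1) by (intro integral_completion) simp
  finally show ?thesis .
qed

text \<open>For almost every \<open>x\<close> the section of the truncated \<open>P\<close> agrees
  almost everywhere with that of \<open>p\<close>, which is Borel. The remaining \<open>x\<close>,
  where the inner integral may be a mere default value, form a null set that the outer integral
  ignores. So the preceding lemma applies once to the inner and once to the outer integral, and
  Fubini's theorem is needed for \<open>p\<close> only.\<close>

lemma integral_lebesgue_pair_eq:
  fixes p :: "'a::euclidean_space \<times> 'b::euclidean_space \<Rightarrow> real"
  assumes p: "integrable lborel p"
    and ae: "AE w in lborel. indicator (A \<times> B) w * P w = p w"
  shows "(LINT x:A|lebesgue. LINT y:B|lebesgue. P (x, y)) = (LINT w|lborel. p w)"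
proof -
  have p': "integrable (lborel \<Otimes>\<^sub>M lborel) p"
    using p by (simp add: lborel_prod)
  have [measurable]: "p \<in> borel_measurable (lborel \<Otimes>\<^sub>M lborel)"
    using p' by simp
  have "AE x in lborel. AE y in lborel. indicator (A \<times> B) (x, y) * P (x, y) = p (x, y)"
    using ae by (intro lborel_pair.AE_pair) (unfold lborel_prod)
  then have "AE x in lborel. indicator A x * (LINT y:B|lebesgue. P (x, y)) = (LINT y|lborel. p (x, y))"
  proof eventually_elim
    case (elim x)
    have "(\<lambda>y. p (x, y)) \<in> borel_measurable lborel"
      by measurable
    then have "(LINT y|lebesgue. indicator A x * (indicator B y * P (x, y))) = (LINT y|lborel. p (x, y))"
      by (rule integral_lebesgue_cong_AE_borel) (use elim in \<open>simp add: indicator_times mult.assoc\<close>)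
    then show ?case
      by (simp add: set_lebesgue_integral_def)
  qed
  moreover have "(\<lambda>x. LINT y|lborel. p (x, y)) \<in> borel_measurable lborel"
    using lborel.borel_measurable_lebesgue_integral[of "\<lambda>x y. p (x, y)" lborel] by simp
  ultimately have "(LINT x|lebesgue. indicator A x * (LINT y:B|lebesgue. P (x, y)))
      = (LINT x|lborel. LINT y|lborel. p (x, y))"
    by (intro integral_lebesgue_cong_AE_borel) auto
  also have "\<dots> = (LINT w|lborel. p w)"
    using lborel_pair.integral_fst'[OF p'] by (simp add: lborel_prod)
  finally show ?thesis
    by (simp add: set_lebesgue_integral_def)
qed

section \<open>Fubini's theorem for kernels supported on compact sets\<close>

lemma compact_continuous_bound_indicator:
  fixes h :: "'a::euclidean_space \<Rightarrow> real"
  assumes "compact E" "continuous_on E h"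
  obtains B where "0 \<le> B" "\<And>x. \<bar>indicator E x * h x\<bar> \<le> B"
proof -
  have "bounded (h ` E)"
    using assms by (intro compact_imp_bounded compact_continuous_image)
  then obtain B where B: "0 < B" "\<And>x. x \<in> E \<Longrightarrow> \<bar>h x\<bar> \<le> B"
    unfolding bounded_pos by auto
  then show ?thesis
    by (intro that[of B]) (auto simp: indicator_def)
qed

lemma borel_measurable_indicator_compact:
  fixes h :: "'a::euclidean_space \<Rightarrow> real"
  assumes "compact E" "continuous_on E h"
  shows "(\<lambda>x. indicator E x * h x) \<in> borel_measurable borel"
  using borel_measurable_continuous_on_indicator[of E h] assms
  by (simp add: compact_imp_closed borel_closed)

lemma integrable_mult_compact:
  fixes p h :: "'a::euclidean_space \<Rightarrow> real"
  assumes p: "integrable lborel p" and E: "compact E" "continuous_on E h"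
  shows "integrable lborel (\<lambda>x. p x * (indicator E x * h x))"
proof -
  obtain B where B: "0 \<le> B" "\<And>x. \<bar>indicator E x * h x\<bar> \<le> B"
    using compact_continuous_bound_indicator[OF E] by blast
  have [measurable]: "(\<lambda>x. indicator E x * h x) \<in> borel_measurable borel"
    using E by (rule borel_measurable_indicator_compact)
  have [measurable]: "p \<in> borel_measurable borel" using p by auto
  show ?thesis
  proof (rule Bochner_Integration.integrable_bound)
    show "integrable lborel (\<lambda>x. B * p x)" using p by simp
    show "AE x in lborel. norm (p x * (indicator E x * h x)) \<le> norm (B * p x)"
      using B by (auto simp: abs_mult mult.commute[of B] intro!: mult_left_mono)
  qed measurable
qed

text \<open>The kernel is bounded by some \<open>B\<close> and vanishes unless \<open>x\<close> lies
  in the projection \<open>X\<close> of \<open>E\<close>. As \<open>X\<close> is compact, it has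
  finite measure, so \<open>B * (indicator X x * p w)\<close> is an integrable majorant on the
  product space.\<close>

lemma Fubini_compact_kernel:
  fixes p :: "'b::euclidean_space \<Rightarrow> real" and h :: "'a::euclidean_space \<times> 'b \<Rightarrow> real"
  assumes p: "integrable lborel p" and E: "compact E" "continuous_on E h"
  defines "k \<equiv> \<lambda>x. indicator E x * h x"
  shows "integrable lborel (\<lambda>x. LINT w|lborel. p w * k (x, w))"
    and "integrable lborel (\<lambda>w. p w * (LINT x|lborel. k (x, w)))"
    and "(LINT x|lborel. LINT w|lborel. p w * k (x, w)) = (LINT w|lborel. p w * (LINT x|lborel. k (x, w)))"
proof -
  obtain B where B: "0 \<le> B" "\<And>x. \<bar>k x\<bar> \<le> B"
    using compact_continuous_bound_indicator[OF E] unfolding k_def by blast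
  have [measurable]: "k \<in> borel_measurable borel"
    unfolding k_def using E by (rule borel_measurable_indicator_compact)
  have [measurable]: "p \<in> borel_measurable borel" using p by auto
  define X where "X = fst ` E"
  have X: "compact X"
    unfolding X_def by (intro compact_continuous_image continuous_intros E)
  then have [measurable]: "X \<in> sets borel"
    by (simp add: compact_imp_closed borel_closed)
  have "integrable (lborel \<Otimes>\<^sub>M lborel) (\<lambda>(x, w). B * (indicator X x * p w))"
  proof (rule lborel_pair.Fubini_integrable)
    show "(\<lambda>(x, w). B * (indicator X x * p w)) \<in> borel_measurable (lborel \<Otimes>\<^sub>M lborel)"
      by measurable
    have "integrable lborel (\<lambda>x. indicator X x * (B * (LINT w|lborel. \<bar>p w\<bar>)))"
      using emeasure_compact_finite[OF X]
      by (intro integrable_mult_left integrable_real_indicator) auto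
    then show "integrable lborel (\<lambda>x. LINT w|lborel. norm (case (x, w) of (x, w) \<Rightarrow> B * (indicator X x * p w)))"
      using B(1) by (simp add: abs_mult mult_ac)
  qed (use p in simp)
  then have int: "integrable (lborel \<Otimes>\<^sub>M lborel) (\<lambda>(x, w). p w * k (x, w))"
  proof (rule Bochner_Integration.integrable_bound)
    show "(\<lambda>(x, w). p w * k (x, w)) \<in> borel_measurable (lborel \<Otimes>\<^sub>M lborel)"
      by measurable
    have "\<bar>p w * k (x, w)\<bar> \<le> \<bar>B * (indicator X x * p w)\<bar>" for x w
    proof (cases "x \<in> X")
      case True
      then show ?thesis
        using B by (auto simp: abs_mult mult.commute[of B] intro!: mult_left_mono)
    next
      case False
      then have "(x, w) \<notin> E" unfolding X_def by force
      then show ?thesis by (simp add: k_def)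
    qed
    then show "AE x in lborel \<Otimes>\<^sub>M lborel. norm (case x of (x, w) \<Rightarrow> p w * k (x, w))
        \<le> norm (case x of (x, w) \<Rightarrow> B * (indicator X x * p w))"
      by (auto simp: case_prod_unfold)
  qed
  show "integrable lborel (\<lambda>x. LINT w|lborel. p w * k (x, w))"
    using lborel_pair.integrable_fst[OF int] .
  show "integrable lborel (\<lambda>w. p w * (LINT x|lborel. k (x, w)))"
    using lborel_pair.integrable_snd[OF int] by simp
  show "(LINT x|lborel. LINT w|lborel. p w * k (x, w)) = (LINT w|lborel. p w * (LINT x|lborel. k (x, w)))"
    using lborel_pair.Fubini_integral[OF int] by simp
qed

section \<open>Taylor's formula on a rectangle\<close>

text \<open>Each one-variable remainder enters with a minus sign. Hence the two single remainders
  are subtracted, while the double one, a remainder of a remainder, is added.\<close>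

lemma taylor_rectangle:
  assumes F: "has_continuous_partials f F (M + 1) (N + 1) {a..b} {c..d}"
    and y: "y \<in> {a..b}" and z: "z \<in> {c..d}"
  shows "f (y, z) =
      (\<Sum>i=0..M. \<Sum>j=0..N. taylor_weight i b y * taylor_weight j d z * F i j (b, d))
    - (\<Sum>j=0..N. LINT s:{y..b}|lebesgue.
         taylor_weight M s y * taylor_weight j d z * F (M + 1) j (s, d))
    - (\<Sum>i=0..M. LINT t:{z..d}|lebesgue.
         taylor_weight i b y * taylor_weight N t z * F i (N + 1) (b, t))
    + (LINT s:{y..b}|lebesgue. LINT t:{z..d}|lebesgue.
         taylor_weight M s y * taylor_weight N t z * F (M + 1) (N + 1) (s, t))"
proof -
  have f: "F 0 0 (y, z) = f (y, z)"
    using F y z by (auto simp: has_continuous_partials_def)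
  have Fy: "((\<lambda>u. F i j (u, v)) has_real_derivative F (Suc i) j (u, v)) (at u within {a..b})"
    if "i \<le> M" "j \<le> N + 1" "u \<in> {a..b}" "v \<in> {c..d}" for i j u v
    using F that unfolding has_continuous_partials_def by (auto simp: less_Suc_eq_le)
  have Fz: "((\<lambda>v. F i j (u, v)) has_real_derivative F i (Suc j) (u, v)) (at v within {c..d})"
    if "i \<le> M + 1" "j \<le> N" "u \<in> {a..b}" "v \<in> {c..d}" for i j u v
    using F that unfolding has_continuous_partials_def by (auto simp: less_Suc_eq_le)
  have cont: "continuous_on ({a..b} \<times> {c..d}) (F i j)" if "i \<le> M + 1" "j \<le> N + 1" for i j
    using F that unfolding has_continuous_partials_def by auto
  have conty: "continuous_on {a..b} (\<lambda>u. F i j (u, v))"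
    if "i \<le> M + 1" "j \<le> N + 1" "v \<in> {c..d}" for i j v
    by (intro continuous_on_compose2[OF cont[OF that(1,2)]] continuous_intros) (use that in auto)
  have contz: "continuous_on {c..d} (\<lambda>v. F i j (u, v))"
    if "i \<le> M + 1" "j \<le> N + 1" "u \<in> {a..b}" for i j u
    by (intro continuous_on_compose2[OF cont[OF that(1,2)]] continuous_intros) (use that in auto)
  have b: "b \<in> {a..b}" and d: "d \<in> {c..d}" using y z by auto
  let ?R = "\<lambda>i s. LINT t:{z..d}|lebesgue. taylor_weight N t z * F i (N + 1) (s, t)"
  \<comment> \<open>Stated for all \<open>i\<close> \<le> \<open>M + 1\<close> and all
    \<open>s\<close>, to cover both the coefficients, where \<open>s = b\<close>, and the integrand
    of the \<open>y\<close>-remainder, where \<open>i = M + 1\<close>.\<close>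
  have expand_z: "F i 0 (s, z) = (\<Sum>j=0..N. taylor_weight j d z * F i j (s, d)) - ?R i s"
    if i: "i \<le> M + 1" and s: "s \<in> {a..b}" for i s
    using taylor_right_endpoint[of z c d N "\<lambda>j t. F i j (s, t)"] z Fz[OF i _ s] contz[OF i _ s]
    by simp
  have "f (y, z) = (\<Sum>i=0..M. taylor_weight i b y * F i 0 (b, z))
      - (LINT s:{y..b}|lebesgue. taylor_weight M s y * F (M + 1) 0 (s, z))"
    using taylor_right_endpoint[of y a b M "\<lambda>i s. F i 0 (s, z)"] y Fy[OF _ _ _ z] conty[OF _ _ z] f
    by simp
  also have "(\<Sum>i=0..M. taylor_weight i b y * F i 0 (b, z)) =
      (\<Sum>i=0..M. \<Sum>j=0..N. taylor_weight i b y * taylor_weight j d z * F i j (b, d))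
      - (\<Sum>i=0..M. taylor_weight i b y * ?R i b)"
    by (simp add: expand_z[OF _ b] right_diff_distrib sum_subtractf sum_distrib_left mult.assoc)
  also have "(\<Sum>i=0..M. taylor_weight i b y * ?R i b) = (\<Sum>i=0..M. LINT t:{z..d}|lebesgue.
      taylor_weight i b y * taylor_weight N t z * F i (N + 1) (b, t))"
    by (simp add: mult.assoc)
  also have "(LINT s:{y..b}|lebesgue. taylor_weight M s y * F (M + 1) 0 (s, z)) =
      (\<Sum>j=0..N. LINT s:{y..b}|lebesgue.
         taylor_weight M s y * taylor_weight j d z * F (M + 1) j (s, d))
      - (LINT s:{y..b}|lebesgue. taylor_weight M s y * ?R (M + 1) s)"
  proof -
    let ?G = "\<lambda>j s. taylor_weight M s y * taylor_weight j d z * F (M + 1) j (s, d)"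
    have G: "set_integrable lebesgue {y..b} (?G j)" if "j \<le> N" for j
      by (intro absolutely_integrable_continuous_real continuous_intros
          continuous_on_subset[OF conty]) (use that y d in auto)
    have H: "set_integrable lebesgue {y..b} (\<lambda>s. taylor_weight M s y * F (M + 1) 0 (s, z))"
      by (intro absolutely_integrable_continuous_real continuous_intros
          continuous_on_subset[OF conty]) (use y z in auto)
    have sumG: "set_integrable lebesgue {y..b} (\<lambda>s. \<Sum>j=0..N. ?G j s)"
      "(LINT s:{y..b}|lebesgue. \<Sum>j=0..N. ?G j s) = (\<Sum>j=0..N. LINT s:{y..b}|lebesgue. ?G j s)"
      unfolding set_integrable_def set_lebesgue_integral_def scaleR_sum_right
      by (intro Bochner_Integration.integrable_sum Bochner_Integration.integral_sum
          G[unfolded set_integrable_def]; simp only: atLeastAtMost_iff)+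
    \<comment> \<open>Solving \<open>expand_z\<close> for \<open>?R\<close> exhibits this integrand
      as a difference of functions continuous in \<open>s\<close>. This avoids a separate proof that
      the inner remainder integral is integrable in \<open>s\<close>.\<close>
    have "(LINT s:{y..b}|lebesgue. taylor_weight M s y * ?R (M + 1) s) =
        (LINT s:{y..b}|lebesgue. (\<Sum>j=0..N. ?G j s) - taylor_weight M s y * F (M + 1) 0 (s, z))"
      by (intro set_lebesgue_integral_cong)
        (use y in \<open>auto simp: expand_z right_diff_distrib sum_distrib_left mult.assoc\<close>)
    also have "\<dots> = (\<Sum>j=0..N. LINT s:{y..b}|lebesgue. ?G j s)
        - (LINT s:{y..b}|lebesgue. taylor_weight M s y * F (M + 1) 0 (s, z))"
      using set_integral_diff(2)[OF sumG(1) H] sumG(2) by simp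
    finally show ?thesis by simp
  qed
  also have "(LINT s:{y..b}|lebesgue. taylor_weight M s y * ?R (M + 1) s) =
      (LINT s:{y..b}|lebesgue. LINT t:{z..d}|lebesgue.
         taylor_weight M s y * taylor_weight N t z * F (M + 1) (N + 1) (s, t))"
    by (simp add: mult.assoc)
  finally show ?thesis by simp
qed

section \<open>Interchanging the remainder parameters with the plane integral\<close>

text \<open>The rectangle may be smaller than the set \<open>R\<close> on which \<open>p\<close>
  represents \<open>P\<close>, so a single \<open>p\<close> serves all the rectangles that arise as
  \<open>s\<close> and \<open>t\<close> vary.\<close>

lemma iterated_lebesgue_integral_eq:
  fixes p :: "real \<times> real \<Rightarrow> real"
  assumes p: "integrable lborel p"
    and ae: "AE w in lborel. indicator R w * P w = p w"
    and sub: "{a..b} \<times> {c..d} \<subseteq> R"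
    and h: "continuous_on ({a..b} \<times> {c..d}) h"
  shows "(LINT y:{a..b}|lebesgue. LINT z:{c..d}|lebesgue. P (y, z) * h (y, z))
    = (LINT w|lborel. p w * (indicator ({a..b} \<times> {c..d}) w * h w))"
proof (rule integral_lebesgue_pair_eq)
  show "integrable lborel (\<lambda>w. p w * (indicator ({a..b} \<times> {c..d}) w * h w))"
    by (intro integrable_mult_compact p h compact_Times compact_Icc)
  show "AE w in lborel. indicator ({a..b} \<times> {c..d}) w * (P w * h w)
      = p w * (indicator ({a..b} \<times> {c..d}) w * h w)"
    using ae by eventually_elim (use sub in \<open>auto simp: indicator_def\<close>)
qed


text \<open>The section of \<open>E\<close> at \<open>w\<close> is the projection of the compact set
  \<open>E\<close> \<inter> \<open>(UNIV \<times> {w})\<close>, hence compact itself, and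
  \<open>h\<close> is continuous on it.\<close>

lemma integrable_section_compact:
  fixes h :: "'a::euclidean_space \<times> 'b::euclidean_space \<Rightarrow> real"
  assumes E: "compact E" "continuous_on E h"
  shows "integrable lborel (\<lambda>x. indicator E (x, w) * h (x, w))"
proof -
  let ?S = "{x. (x, w) \<in> E}"
  have "?S = fst ` (E \<inter> (UNIV \<times> {w}))" by force
  moreover have "compact (E \<inter> (UNIV \<times> {w}))"
    by (intro compact_Int_closed E closed_Times closed_UNIV closed_singleton)
  ultimately have "compact ?S"
    by (simp add: compact_continuous_image continuous_on_fst)
  moreover have "continuous_on ?S (\<lambda>x. h (x, w))"
    by (intro continuous_on_compose2[OF E(2)] continuous_intros) auto
  ultimately have "integrable lborel (\<lambda>x. indicator ?S x *\<^sub>R h (x, w))"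
    by (rule borel_integrable_compact)
  then show ?thesis by (simp add: indicator_def)
qed

text \<open>Common form of the three remainder terms: \<open>x\<close> is the remainder parameter,
  and \<open>(y, z)\<close> runs over a rectangle with upper corner
  \<open>(\<sigma> x, \<tau> x)\<close>. The moving bounds are absorbed into the set
  \<open>E\<close>, which is compact because it is cut out of a compact box by closed conditions. On
  the right, the same conditions restrict \<open>x\<close> for given \<open>(y, z)\<close>.\<close>

lemma Fubini_lower_rectangles:
  fixes p :: "real \<times> real \<Rightarrow> real" and h :: "'a::euclidean_space \<times> (real \<times> real) \<Rightarrow> real"
    and \<sigma> \<tau> :: "'a \<Rightarrow> real"
  assumes p: "integrable lborel p"
    and ae: "AE w in lborel. indicator ({a..b} \<times> {c..d}) w * P w = p w"
    and T: "compact T" and cont: "continuous_on UNIV \<sigma>" "continuous_on UNIV \<tau>"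
    and le: "\<And>x. x \<in> T \<Longrightarrow> \<sigma> x \<le> b" "\<And>x. x \<in> T \<Longrightarrow> \<tau> x \<le> d"
    and E: "E = {(x, y, z). x \<in> T \<and> y \<in> {a..b} \<and> z \<in> {c..d} \<and> y \<le> \<sigma> x \<and> z \<le> \<tau> x}"
    and h: "continuous_on E h"
  defines "g \<equiv> \<lambda>x. LINT y:{a..\<sigma> x}|lebesgue. LINT z:{c..\<tau> x}|lebesgue. P (y, z) * h (x, y, z)"
  shows "compact E"
    and "integrable lborel (\<lambda>x. indicator T x * g x)"
    and "integrable lborel (\<lambda>w. p w * (LINT x|lborel. indicator E (x, w) * h (x, w)))"
    and "(LINT x|lborel. indicator T x * g x)
      = (LINT w|lborel. p w * (LINT x|lborel. indicator E (x, w) * h (x, w)))"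
proof -
  have "E = (T \<times> ({a..b} \<times> {c..d})) \<inter> {x. fst (snd x) \<le> \<sigma> (fst x)} \<inter> {x. snd (snd x) \<le> \<tau> (fst x)}"
    unfolding E by auto
  moreover have "compact \<dots>"
    by (intro compact_Int_closed compact_Times T compact_Icc closed_Collect_le
        continuous_intros continuous_on_compose2[OF cont(1)] continuous_on_compose2[OF cont(2)]) auto
  ultimately show E': "compact E" by simp
  \<comment> \<open>This holds for every \<open>x\<close>, not just almost every one, so
    measurability and integrability of \<open>g\<close> are inherited from the Borel side.\<close>
  have g: "indicator T x * g x = (LINT w|lborel. p w * (indicator E (x, w) * h (x, w)))" for x
  proof (cases "x \<in> T")
    case True
    then have "continuous_on ({a..\<sigma> x} \<times> {c..\<tau> x}) (\<lambda>w. h (x, w))"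
      by (intro continuous_on_compose2[OF h] continuous_intros) (use le[OF True] E in auto)
    then have "g x = (LINT w|lborel. p w * (indicator ({a..\<sigma> x} \<times> {c..\<tau> x}) w * h (x, w)))"
      unfolding g_def using le[OF True] by (intro iterated_lebesgue_integral_eq[OF p ae]) auto
    moreover have "indicator ({a..\<sigma> x} \<times> {c..\<tau> x}) w = (indicator E (x, w) :: real)" for w
      using True le[OF True] unfolding E by (auto simp: indicator_def)
    ultimately show ?thesis using True by simp
  qed (simp add: E)
  show "integrable lborel (\<lambda>x. indicator T x * g x)"
    "integrable lborel (\<lambda>w. p w * (LINT x|lborel. indicator E (x, w) * h (x, w)))"
    "(LINT x|lborel. indicator T x * g x)
      = (LINT w|lborel. p w * (LINT x|lborel. indicator E (x, w) * h (x, w)))"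
    unfolding g using Fubini_compact_kernel[OF p E' h] by simp_all
qed

text \<open>A Lebesgue measurable function has a Borel version; multiplying it by
  \<open>indicator S\<close> makes it vanish everywhere outside \<open>S\<close>, not only almost
  everywhere.\<close>

lemma absolutely_integrable_borel_version:
  fixes P :: "'a::euclidean_space \<Rightarrow> real"
  assumes P: "P absolutely_integrable_on S" and S: "S \<in> sets borel"
  obtains p where "integrable lborel p" "AE x in lborel. indicator S x * P x = p x"
    "\<And>x. x \<notin> S \<Longrightarrow> p x = 0"
proof -
  have int: "integrable lebesgue (\<lambda>x. indicator S x * P x)"
    using P by (simp add: set_integrable_def)
  then obtain p0 where p0: "p0 \<in> borel_measurable lborel" "AE x in lborel. indicator S x * P x = p0 x"
    using completion_ex_borel_measurable_real[of "\<lambda>x. indicator S x * P x" lborel] by auto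
  define p where "p = (\<lambda>x. indicator S x * p0 x)"
  have p: "p \<in> borel_measurable lborel"
    unfolding p_def using p0(1) S by simp
  have ae: "AE x in lborel. indicator S x * P x = p x"
    using p0(2) by eventually_elim (auto simp: p_def indicator_def split: if_splits)
  have "integrable lebesgue p"
    using integrable_cong_AE[OF borel_measurable_integrable[OF int] measurable_completion[OF p]
        AE_completion[OF ae]] int by blast
  then have "integrable lborel p"
    using p by (simp add: integrable_completion)
  then show ?thesis using ae by (intro that[of p]) (auto simp: p_def)
qed

section \<open>The weighted formula on the rectangle\<close>

theorem theorem4p2:
  fixes a b c d :: real and M N :: nat
    and P f :: "real \<times> real \<Rightarrow> real"
    and F :: "nat \<Rightarrow> nat \<Rightarrow> real \<times> real \<Rightarrow> real"
  assumes "a \<le> b" and "c \<le> d"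
    and "P absolutely_integrable_on ({a..b} \<times> {c..d})"
    and "f absolutely_integrable_on ({a..b} \<times> {c..d})"
    and "has_continuous_partials f F (M + 1) (N + 1) {a..b} {c..d}"
  shows
    "(LINT y:{a..b}|lebesgue. LINT z:{c..d}|lebesgue. P (y, z) * f (y, z)) =
       (\<Sum>i=0..M. \<Sum>j=0..N. (LINT y:{a..b}|lebesgue. LINT z:{c..d}|lebesgue.
          P (y, z) * ((b - y) ^ i / fact i) * ((d - z) ^ j / fact j)
            * (-1) ^ (i + j) * F i j (b, d)))
     + (\<Sum>j=0..N. (LINT s:{a..b}|lebesgue. LINT y:{a..s}|lebesgue. LINT z:{c..d}|lebesgue.
          P (y, z) * ((s - y) ^ M / fact M) * ((d - z) ^ j / fact j)
            * (-1) ^ (M + j + 1) * F (M + 1) j (s, d)))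
     + (\<Sum>i=0..M. (LINT t:{c..d}|lebesgue. LINT y:{a..b}|lebesgue. LINT z:{c..t}|lebesgue.
          P (y, z) * ((b - y) ^ i / fact i) * ((t - z) ^ N / fact N)
            * (-1) ^ (i + N + 1) * F i (N + 1) (b, t)))
     + (LINT s:{a..b}|lebesgue. LINT t:{c..d}|lebesgue.
          LINT y:{a..s}|lebesgue. LINT z:{c..t}|lebesgue.
          P (y, z) * ((s - y) ^ M / fact M) * ((t - z) ^ N / fact N)
            * (-1) ^ (M + N) * F (M + 1) (N + 1) (s, t))"
proof -
  let ?R = "{a..b} \<times> {c..d}"
  note F = assms(5)
  obtain p where p: "integrable lborel p" and ae: "AE w in lborel. indicator ?R w * P w = p w"
    and p0: "\<And>w. w \<notin> ?R \<Longrightarrow> p w = 0"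
    by (rule absolutely_integrable_borel_version[OF assms(3)]) (auto intro: borel_closed closed_Times)
  have contF: "continuous_on ?R (F i j)" if "i \<le> M + 1" "j \<le> N + 1" for i j
    using F that unfolding has_continuous_partials_def by auto
  have contf: "continuous_on ?R f"
    using contF[of 0 0] continuous_on_cong[of ?R ?R "F 0 0" f] F
    unfolding has_continuous_partials_def by blast

  \<comment> \<open>The factors of \<open>P\<close> in the four kinds of terms, with the remainder
    parameter as first component. The minus signs in \<open>h2\<close> and \<open>h3\<close> account
    for the extra \<open>1\<close> in the exponents \<open>M + j + 1\<close> and
    \<open>i + N + 1\<close>.\<close>
  define h1 where "h1 i j w = taylor_weight i b (fst w) * taylor_weight j d (snd w) * F i j (b, d)"
    for i j w
  define h2 where "h2 j x = - (taylor_weight M (fst x) (fst (snd x)) * taylor_weight j d (snd (snd x))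
      * F (M + 1) j (fst x, d))" for j x
  define h3 where "h3 i x = - (taylor_weight i b (fst (snd x)) * taylor_weight N (fst x) (snd (snd x))
      * F i (N + 1) (b, fst x))" for i x
  define h4 where "h4 x = taylor_weight M (fst (fst x)) (fst (snd x))
      * taylor_weight N (snd (fst x)) (snd (snd x)) * F (M + 1) (N + 1) (fst x)" for x
  \<comment> \<open>\<open>E2\<close>, \<open>E3\<close>, \<open>E4\<close> are the sets
    \<open>E\<close> of \<open>Fubini_lower_rectangles\<close> for the upper corners
    \<open>(s, d)\<close>, \<open>(b, t)\<close> and \<open>(s, t)\<close>.\<close>
  define E2 where "E2 = {(s, y, z). s \<in> {a..b} \<and> y \<in> {a..b} \<and> z \<in> {c..d} \<and> y \<le> s \<and> z \<le> d}"
  define E3 where "E3 = {(t, y, z). t \<in> {c..d} \<and> y \<in> {a..b} \<and> z \<in> {c..d} \<and> y \<le> b \<and> z \<le> t}"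
  define E4 where "E4 = {(x, y, z). x \<in> ?R \<and> y \<in> {a..b} \<and> z \<in> {c..d} \<and> y \<le> fst x \<and> z \<le> snd x}"
  \<comment> \<open>What multiplies \<open>p w\<close> once the parameters are integrated out. Each
    term of the claim becomes the integral of \<open>p w\<close> times one of these, which reduces
    the theorem to an identity at each point \<open>w\<close>.\<close>
  define k1 where "k1 i j w = indicator ?R w * h1 i j w" for i j w
  define k2 where "k2 j w = (LINT s|lborel. indicator E2 (s, w) * h2 j (s, w))" for j w
  define k3 where "k3 i w = (LINT t|lborel. indicator E3 (t, w) * h3 i (t, w))" for i w
  define k4 where "k4 w = (LINT x|lborel. indicator E4 (x, w) * h4 (x, w))" for w

  have h1: "continuous_on ?R (h1 i j)" for i j
    unfolding h1_def by (intro continuous_intros)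
  have h2: "continuous_on E2 (h2 j)" if "j \<le> N" for j
    unfolding h2_def by (intro continuous_intros continuous_on_compose2[OF contF[of "M + 1" j]])
      (use that assms(2) in \<open>auto simp: E2_def\<close>)
  have h3: "continuous_on E3 (h3 i)" if "i \<le> M" for i
    unfolding h3_def by (intro continuous_intros continuous_on_compose2[OF contF[of i "N + 1"]])
      (use that assms(1) in \<open>auto simp: E3_def\<close>)
  have h4: "continuous_on E4 h4"
    unfolding h4_def by (intro continuous_intros continuous_on_compose2[OF contF[of "M + 1" "N + 1"]])
      (auto simp: E4_def)

  note lower2 = Fubini_lower_rectangles[OF p ae compact_Icc[of a b] continuous_on_id
      continuous_on_const[of _ d] _ _ E2_def h2, simplified id_apply, folded k2_def]
  note lower3 = Fubini_lower_rectangles[OF p ae compact_Icc[of c d] continuous_on_const[of _ b]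
      continuous_on_id _ _ E3_def h3, simplified id_apply, folded k3_def]
  note lower4 = Fubini_lower_rectangles[OF p ae compact_Times[OF compact_Icc compact_Icc, of a b c d]
      continuous_on_fst[OF continuous_on_id] continuous_on_snd[OF continuous_on_id] _ _ E4_def h4,
      folded k4_def]

  \<comment> \<open>On \<open>?R\<close> this is \<open>taylor_rectangle\<close> multiplied by
    \<open>p w\<close>; off \<open>?R\<close> both sides vanish since
    \<open>p w = 0\<close>.\<close>
  have pointwise: "p w * (indicator ?R w * f w) = (\<Sum>i=0..M. \<Sum>j=0..N. p w * k1 i j w)
      + (\<Sum>j=0..N. p w * k2 j w) + (\<Sum>i=0..M. p w * k3 i w) + p w * k4 w" for w
  proof (cases "w \<in> ?R")
    case True
    then obtain y z where w: "w = (y, z)" and y: "y \<in> {a..b}" and z: "z \<in> {c..d}" by auto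
    \<comment> \<open>For fixed \<open>w = (y, z)\<close> in \<open>?R\<close> the section of
      \<open>E2\<close> in \<open>s\<close> is exactly \<open>{y..b}\<close>, the range of the
      Taylor remainder.\<close>
    have 2: "(LINT s:{y..b}|lebesgue. taylor_weight M s y * taylor_weight j d z * F (M + 1) j (s, d))
        = - k2 j w" if "j \<le> N" for j
    proof -
      have "(LINT s:{y..b}|lebesgue. h2 j (s, w)) = k2 j w"
        unfolding k2_def set_lebesgue_integral_def
        by (intro integral_lebesgue_cong_AE_borel borel_measurable_integrable
            integrable_section_compact lower2(1) h2 that)
          (use y z in \<open>auto simp: E2_def w indicator_def\<close>)
      then show ?thesis by (simp add: h2_def w set_lebesgue_integral_def)
    qed
    have 3: "(LINT t:{z..d}|lebesgue. taylor_weight i b y * taylor_weight N t z * F i (N + 1) (b, t))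
        = - k3 i w" if "i \<le> M" for i
    proof -
      have "(LINT t:{z..d}|lebesgue. h3 i (t, w)) = k3 i w"
        unfolding k3_def set_lebesgue_integral_def
        by (intro integral_lebesgue_cong_AE_borel borel_measurable_integrable
            integrable_section_compact lower3(1) h3 that)
          (use y z in \<open>auto simp: E3_def w indicator_def\<close>)
      then show ?thesis by (simp add: h3_def w set_lebesgue_integral_def)
    qed
    have 4: "(LINT s:{y..b}|lebesgue. LINT t:{z..d}|lebesgue.
        taylor_weight M s y * taylor_weight N t z * F (M + 1) (N + 1) (s, t)) = k4 w"
    proof -
      \<comment> \<open>The passage from iterated to plane integrals is used here in the parameters
        \<open>(s, t)\<close>, with \<open>w\<close> fixed.\<close>
      have "(LINT s:{y..b}|lebesgue. LINT t:{z..d}|lebesgue. h4 ((s, t), w)) = k4 w"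
        unfolding k4_def
        by (intro integral_lebesgue_pair_eq integrable_section_compact lower4(1) h4)
          (use y z in \<open>auto simp: E4_def w indicator_def\<close>)
      then show ?thesis by (simp add: h4_def w)
    qed
    have "f w = (\<Sum>i=0..M. \<Sum>j=0..N. k1 i j w) + (\<Sum>j=0..N. k2 j w) + (\<Sum>i=0..M. k3 i w) + k4 w"
      using taylor_rectangle[OF F y z] True by (simp add: 2[simplified] 3[simplified] 4[simplified] k1_def h1_def w sum_negf)
    then show ?thesis using True by (simp add: distrib_left sum_distrib_left)
  qed (simp add: p0)

  have 1: "integrable lborel (\<lambda>w. p w * k1 i j w)" for i j
    unfolding k1_def by (intro integrable_mult_compact p h1 compact_Times compact_Icc)
  have 2: "integrable lborel (\<lambda>w. p w * k2 j w)" if "j \<le> N" for j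
    using that by (intro lower2) auto
  have 3: "integrable lborel (\<lambda>w. p w * k3 i w)" if "i \<le> M" for i
    using that by (intro lower3) auto
  have 4: "integrable lborel (\<lambda>w. p w * k4 w)"
    by (intro lower4) auto

  have e1: "P (y, z) * ((b - y) ^ i / fact i) * ((d - z) ^ j / fact j) * (-1) ^ (i + j) * F i j (b, d)
      = P (y, z) * h1 i j (y, z)" for y z i j
    by (simp add: h1_def taylor_weight_def power_add mult_ac)
  have e2: "P (y, z) * ((s - y) ^ M / fact M) * ((d - z) ^ j / fact j)
      * (-1) ^ (M + j + 1) * F (M + 1) j (s, d) = P (y, z) * h2 j (s, y, z)" for y z s j
    by (simp add: h2_def taylor_weight_def power_add mult_ac)
  have e3: "P (y, z) * ((b - y) ^ i / fact i) * ((t - z) ^ N / fact N)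
      * (-1) ^ (i + N + 1) * F i (N + 1) (b, t) = P (y, z) * h3 i (t, y, z)" for y z t i
    by (simp add: h3_def taylor_weight_def power_add mult_ac)
  have e4: "P (y, z) * ((s - y) ^ M / fact M) * ((t - z) ^ N / fact N)
      * (-1) ^ (M + N) * F (M + 1) (N + 1) (s, t) = P (y, z) * h4 ((s, t), y, z)" for y z s t
    by (simp add: h4_def taylor_weight_def power_add mult_ac)
  have T0: "(LINT y:{a..b}|lebesgue. LINT z:{c..d}|lebesgue. P (y, z) * f (y, z))
      = (LINT w|lborel. p w * (indicator ?R w * f w))"
    by (intro iterated_lebesgue_integral_eq[OF p ae] contf) auto
  have T1: "(LINT y:{a..b}|lebesgue. LINT z:{c..d}|lebesgue.
          P (y, z) * ((b - y) ^ i / fact i) * ((d - z) ^ j / fact j)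
            * (-1) ^ (i + j) * F i j (b, d)) = (LINT w|lborel. p w * k1 i j w)" for i j
  proof -
    have "(LINT y:{a..b}|lebesgue. LINT z:{c..d}|lebesgue. P (y, z) * h1 i j (y, z))
        = (LINT w|lborel. p w * k1 i j w)"
      unfolding k1_def by (intro iterated_lebesgue_integral_eq[OF p ae] h1) auto
    then show ?thesis unfolding e1 .
  qed
  have T2: "(LINT s:{a..b}|lebesgue. LINT y:{a..s}|lebesgue. LINT z:{c..d}|lebesgue.
          P (y, z) * ((s - y) ^ M / fact M) * ((d - z) ^ j / fact j)
            * (-1) ^ (M + j + 1) * F (M + 1) j (s, d)) = (LINT w|lborel. p w * k2 j w)"
    if "j \<in> {0..N}" for j
  proof -
    let ?g = "\<lambda>s. LINT y:{a..s}|lebesgue. LINT z:{c..d}|lebesgue. P (y, z) * h2 j (s, y, z)"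
    \<comment> \<open>Supplies the Borel measurability in \<open>s\<close> that allows the outer
      Lebesgue integral to be taken over \<open>lborel\<close>.\<close>
    have int: "integrable lborel (\<lambda>s. indicator {a..b} s * ?g s)"
      using that by (intro lower2) auto
    have "(LINT s:{a..b}|lebesgue. ?g s) = (LINT s|lborel. indicator {a..b} s * ?g s)"
      unfolding set_lebesgue_integral_def[of lebesgue "{a..b}"] real_scaleR_def
      using borel_measurable_integrable[OF int] by (rule integral_lebesgue_cong_AE_borel) (rule AE_I2, rule refl)
    also have "\<dots> = (LINT w|lborel. p w * k2 j w)"
      using that by (intro lower2) auto
    finally show ?thesis unfolding e2 .
  qed
  have T3: "(LINT t:{c..d}|lebesgue. LINT y:{a..b}|lebesgue. LINT z:{c..t}|lebesgue.
          P (y, z) * ((b - y) ^ i / fact i) * ((t - z) ^ N / fact N)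
            * (-1) ^ (i + N + 1) * F i (N + 1) (b, t)) = (LINT w|lborel. p w * k3 i w)"
    if "i \<in> {0..M}" for i
  proof -
    let ?g = "\<lambda>t. LINT y:{a..b}|lebesgue. LINT z:{c..t}|lebesgue. P (y, z) * h3 i (t, y, z)"
    have int: "integrable lborel (\<lambda>t. indicator {c..d} t * ?g t)"
      using that by (intro lower3) auto
    have "(LINT t:{c..d}|lebesgue. ?g t) = (LINT t|lborel. indicator {c..d} t * ?g t)"
      unfolding set_lebesgue_integral_def[of lebesgue "{c..d}"] real_scaleR_def
      using borel_measurable_integrable[OF int] by (rule integral_lebesgue_cong_AE_borel) (rule AE_I2, rule refl)
    also have "\<dots> = (LINT w|lborel. p w * k3 i w)"
      using that by (intro lower3) auto
    finally show ?thesis unfolding e3 .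
  qed
  have T4: "(LINT s:{a..b}|lebesgue. LINT t:{c..d}|lebesgue.
          LINT y:{a..s}|lebesgue. LINT z:{c..t}|lebesgue.
          P (y, z) * ((s - y) ^ M / fact M) * ((t - z) ^ N / fact N)
            * (-1) ^ (M + N) * F (M + 1) (N + 1) (s, t)) = (LINT w|lborel. p w * k4 w)"
  proof -
    let ?g = "\<lambda>x. LINT y:{a..fst x}|lebesgue. LINT z:{c..snd x}|lebesgue. P (y, z) * h4 (x, y, z)"
    \<comment> \<open>The two outer integrals are merged into one over \<open>x = (s, t)\<close>;
      the truncated \<open>?g\<close> is its own Borel version by \<open>lower4(2)\<close>.\<close>
    have "(LINT s:{a..b}|lebesgue. LINT t:{c..d}|lebesgue. ?g (s, t))
        = (LINT x|lborel. indicator ?R x * ?g x)"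
      using lower4(2) by (intro integral_lebesgue_pair_eq) auto
    also have "\<dots> = (LINT w|lborel. p w * k4 w)"
      by (intro lower4) auto
    finally show ?thesis unfolding e4 by simp
  qed
  have "(LINT w|lborel. p w * (indicator ?R w * f w)) =
      (\<Sum>i=0..M. \<Sum>j=0..N. LINT w|lborel. p w * k1 i j w)
      + (\<Sum>j=0..N. LINT w|lborel. p w * k2 j w) + (\<Sum>i=0..M. LINT w|lborel. p w * k3 i w)
      + (LINT w|lborel. p w * k4 w)"
    unfolding pointwise
    by (intro has_bochner_integral_integral_eq has_bochner_integral_add has_bochner_integral_sum
        has_bochner_integral_integrable 1 2 3 4) auto
  then show ?thesis
    unfolding T0 T1 T4
    by (elim trans) (intro arg_cong2[where f="(+)"] sum.cong refl T2[symmetric] T3[symmetric])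
qed

end
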